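(* Let $\mu,\nu,a,b\in\mathbb{C}$ with $a\neq0$, $b\neq0$, $\operatorname{Re}\mu>0$, $\operatorname{Re}\nu>0$ and $\nu b^2\neq\mu a^2$, and set $$\delta=\frac{(b^2-a^2)\mu\nu}{\nu b^2-\mu a^2}.$$ Let $P_n(x)=c_0x^n+c_1x^{n-1}+\cdots+c_n$ be a polynomial with complex coefficients and $c_0\neq0$. Assume $a^k\neq b^k$ for all $1\le k\le n$. Then the following are equivalent: (a) $P_n$ is obtained from the recursion $P_k(x)=2xP_{k-1}(x)-\frac{1}{\delta}P_{k-1}'(x)$, $1\le k\le n$, starting from some nonzero constant $P_0(x)=C$. (b) There is a constant $C_n$ such that for all $z\in\mathbb{C}$ $$\int_{\mathbb{R}}P_n(x)e^{-\mu(x-az)^2}\,dx=C_n\int_{\mathbb{R}}P_n(x)e^{-\nu(x-bz)^2}\,dx.$$ (c) $c_{2k+1}=0$ whenever $2k+1\le n$, and $(n-2k)!\,c_{2k}=-2\delta(2k+2)(n-2k-2)!\,c_{2k+2}$ whenever $2k+2\le n$. Moreover, in these cases $C_n=\frac{\sqrt{\nu}}{\sqrt{\mu}}\left(\frac{a}{b}\right)^n$ and $$P_n(x)=C\sum_{k=0}^{\lfloor n/2\rfloor}\frac{(-1)^k2^nn!}{4^kk!\,(n-2k)!\,\delta^k}x^{n-2k},\qquad C=c_02^{-n}\neq0.$$ In particular, when $\delta=1$ the conditions are equivalent to $P_n$ being a nonzero constant multiple of the Hermite polynomial $H_n(x)=(-1)^ne^{x^2}\frac{d^n}{dx^n}e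^{-x^2}$.
   Context: Square roots are principal: $\sqrt{z}=\sqrt{|z|}e^{i\theta/2}$, $z=|z|e^{i\theta}$, $\theta\in(-\pi,\pi]$. $\lfloor\cdot\rfloor$ is the greatest integer function. *)

theory Defs
  imports "HOL-Analysis.Analysis" "HOL-Computational_Algebra.Polynomial"
begin

definition delta3 :: "complex \<Rightarrow> complex \<Rightarrow> complex \<Rightarrow> complex \<Rightarrow> complex" where
  "delta3 \<mu> \<nu> a b = ((b^2 - a^2) * \<mu> * \<nu>) / (\<nu> * b^2 - \<mu> * a^2)"

fun herm_rec :: "complex \<Rightarrow> complex \<Rightarrow> nat \<Rightarrow> complex poly" where
  "herm_rec d C 0 = [:C:]"
| "herm_rec d C (Suc k) =
     [:0, 2:] * herm_rec d C k - smult (1 / d) (pderiv (herm_rec d C k))"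

definition gauss_int :: "complex poly \<Rightarrow> complex \<Rightarrow> complex \<Rightarrow> complex \<Rightarrow> complex" where
  "gauss_int P m c z =
     integral\<^sup>L lborel (\<lambda>x::real. poly P (of_real x) * exp (- m * (of_real x - c * z)^2))"

definition hermite_fun :: "nat \<Rightarrow> real \<Rightarrow> real" where
  "hermite_fun n x = (-1)^n * exp (x^2) * ((deriv ^^ n) (\<lambda>t::real. exp (- (t^2))) x)"

end

theory Submission
  imports Defs "HOL-Probability.Distributions" "HOL-Real_Asymp.Real_Asymp"
begin

text \<open>
  Let \<open>H\<^sub>s\<close> be the heat operator \<open>exp (s D\<^sup>2)\<close> on polynomials. Integrating by parts,
  \<open>\<integral> P(x) exp (-m (x - w)\<^sup>2) dx = sqrt (\<pi> / m) (H\<^sub>s P)(w)\<close> with \<open>s = 1 / (4 m)\<close>, so condition (b)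
  says that \<open>(H\<^sub>s P)(a z)\<close> and \<open>(H\<^sub>t P)(b z)\<close> are proportional, where \<open>s = 1 / (4 \<mu>)\<close> and
  \<open>t = 1 / (4 \<nu>)\<close>. The Hermite-type polynomial of the recursion is a multiple of
  \<open>H\<^sub>\<kappa> x\<^sup>n\<close> with \<open>\<kappa> = - 1 / (4 \<delta>)\<close>. Since \<open>H\<^sub>s H\<^sub>\<kappa> = H\<^sub>s\<^sub>+\<^sub>\<kappa>\<close> and \<open>H\<^sub>s x\<^sup>n\<close> is homogeneous
  when \<open>s\<close> has weight 2, it satisfies the proportionality because \<open>b\<^sup>2 (s + \<kappa>) = a\<^sup>2 (t + \<kappa>)\<close>,
  which is exactly the definition of \<open>\<delta>\<close>. For uniqueness, subtract from \<open>P\<close> the multiple of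
  \<open>H\<^sub>\<kappa> x\<^sup>n\<close> with the same leading coefficient: a nonzero difference, of degree \<open>j < n\<close>, would satisfy
  the same proportionality, and comparing leading coefficients gives \<open>a\<^sup>n\<^sup>-\<^sup>j = b\<^sup>n\<^sup>-\<^sup>j\<close>.
\<close>

section \<open>Complex Gaussian integrals\<close>

text \<open>Differentiation under the integral sign: the second-order Taylor remainder of
  \<open>exp\<close> integrates to at most \<open>norm h ^ 2 * K\<close>, so the difference quotient
  is off by \<open>O(h)\<close>. It serves for both Gaussian parameters, with \<open>u x\<close>
  equal to \<open>- x^2\<close> or \<open>x\<close>.\<close>

lemma has_field_derivative_integral_exp:
  fixes f u :: "'a \<Rightarrow> complex"
  assumes [measurable]: "f \<in> borel_measurable M" "u \<in> borel_measurable M"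
    and r: "r > 0"
    and f: "integrable M f" and uf: "integrable M (\<lambda>x. u x * f x)"
    and dom: "integrable M (\<lambda>x. exp (r * norm (u x)) * norm (u x) ^ 2 * norm (f x))"
  shows "((\<lambda>h. \<integral>x. exp (h * u x) * f x \<partial>M) has_field_derivative (\<integral>x. u x * f x \<partial>M)) (at 0)"
proof -
  define K where "K = (\<integral>x. exp (r * norm (u x)) * norm (u x) ^ 2 * norm (f x) \<partial>M)"
  define R where "R h x = (exp (h * u x) - 1 - h * u x) * f x" for h x
  have bound: "norm (R h x) \<le> norm h ^ 2 * (exp (r * norm (u x)) * norm (u x) ^ 2 * norm (f x))"
    if "norm h < r" for h x
  proof -
    have "norm (exp (h * u x) - 1 - h * u x) \<le> exp \<bar>Re (h * u x)\<bar> * norm (h * u x) ^ 2"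
      using Taylor_exp[of "h * u x" 1] by (simp add: numeral_2_eq_2 algebra_simps)
    also have "\<bar>Re (h * u x)\<bar> \<le> r * norm (u x)"
      using abs_Re_le_cmod[of "h * u x"] that
      by (smt (verit) mult_right_mono norm_ge_zero norm_mult)
    hence "exp \<bar>Re (h * u x)\<bar> * norm (h * u x) ^ 2 \<le> exp (r * norm (u x)) * norm (h * u x) ^ 2"
      by (intro mult_right_mono) auto
    finally have "norm (R h x) \<le> exp (r * norm (u x)) * norm (h * u x) ^ 2 * norm (f x)"
      unfolding R_def norm_mult[of _ "f x"] by (intro mult_right_mono) auto
    thus ?thesis by (simp add: norm_mult power_mult_distrib mult_ac)
  qed
  have R: "integrable M (R h)" if "norm h < r" for h
  proof (rule Bochner_Integration.integrable_bound)
    show "integrable M (\<lambda>x. norm h ^ 2 * (exp (r * norm (u x)) * norm (u x) ^ 2 * norm (f x)))"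
      using dom by simp
    show "R h \<in> borel_measurable M" unfolding R_def by measurable
    show "AE x in M. norm (R h x) \<le> norm (norm h ^ 2 * (exp (r * norm (u x)) * norm (u x) ^ 2 * norm (f x)))"
      using bound[OF that] by auto
  qed
  have F: "(\<integral>x. exp (h * u x) * f x \<partial>M) = (\<integral>x. f x \<partial>M) + h * (\<integral>x. u x * f x \<partial>M) + (\<integral>x. R h x \<partial>M)"
    if "norm h < r" for h
  proof -
    have "(\<lambda>x. exp (h * u x) * f x) = (\<lambda>x. f x + h * (u x * f x) + R h x)"
      by (auto simp: R_def algebra_simps)
    thus ?thesis using f uf R[OF that] by simp
  qed
  have small: "norm (\<integral>x. R h x \<partial>M) \<le> norm h ^ 2 * K" if "norm h < r" for h
  proof -
    have "norm (\<integral>x. R h x \<partial>M) \<le> (\<integral>x. norm h ^ 2 * (exp (r * norm (u x)) * norm (u x) ^ 2 * norm (f x)) \<partial>M)"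
      using dom bound[OF that] R[OF that]
      by (intro order.trans[OF integral_norm_bound] integral_mono) auto
    thus ?thesis by (simp add: K_def)
  qed
  show ?thesis
    unfolding DERIV_def
  proof (rule LIM_zero_cancel, rule Lim_null_comparison)
    show "\<forall>\<^sub>F h in at 0. norm (((\<integral>x. exp ((0 + h) * u x) * f x \<partial>M) - (\<integral>x. exp (0 * u x) * f x \<partial>M)) / h
        - (\<integral>x. u x * f x \<partial>M)) \<le> norm h * K"
      unfolding eventually_at
    proof (intro exI[of _ r] conjI ballI impI r)
      fix h :: complex assume h: "h \<noteq> 0 \<and> dist h 0 < r"
      hence "((\<integral>x. exp ((0 + h) * u x) * f x \<partial>M) - (\<integral>x. exp (0 * u x) * f x \<partial>M)) / h
          - (\<integral>x. u x * f x \<partial>M) = (\<integral>x. R h x \<partial>M) / h"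
        using F[of h] by (simp add: field_simps)
      thus "norm (((\<integral>x. exp ((0 + h) * u x) * f x \<partial>M) - (\<integral>x. exp (0 * u x) * f x \<partial>M)) / h
          - (\<integral>x. u x * f x \<partial>M)) \<le> norm h * K"
        using small[of h] h by (simp add: norm_divide field_simps power2_eq_square)
    qed
    have "((\<lambda>h::complex. norm h * K) \<longlongrightarrow> norm (0::complex) * K) (at 0)" by (intro tendsto_intros)
    thus "((\<lambda>h::complex. norm h * K) \<longlongrightarrow> 0) (at 0)" by simp
  qed
qed

section \<open>Gaussian domination and integrability\<close>

lemma power_exp_le_gaussian:
  fixes s c x :: real
  assumes s: "s > 0"
  shows "\<bar>x\<bar> ^ k * exp (c * \<bar>x\<bar> - s * x\<^sup>2) \<le> fact k * exp ((c + 1)\<^sup>2 / (2 * s)) * exp (- (s / 2) * x\<^sup>2)"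
proof -
  have "\<bar>x\<bar> ^ k / fact k \<le> exp \<bar>x\<bar>"
  proof -
    \<comment> \<open>One term of the exponential series trades the power of \<open>x\<close> for an
      extra \<open>\<bar>x\<bar>\<close> in the exponent.\<close>
    have "(\<Sum>i\<in>{k}. inverse (fact i) * \<bar>x\<bar> ^ i) \<le> (\<Sum>i. inverse (fact i) * \<bar>x\<bar> ^ i)"
      using summable_exp[of "\<bar>x\<bar>"] by (intro sum_le_suminf) auto
    thus ?thesis by (simp add: exp_def divide_inverse mult.commute)
  qed
  hence "\<bar>x\<bar> ^ k * exp (c * \<bar>x\<bar> - s * x\<^sup>2) \<le> (fact k * exp \<bar>x\<bar>) * exp (c * \<bar>x\<bar> - s * x\<^sup>2)"
    by (intro mult_right_mono) (auto simp: field_simps)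
  also have "\<dots> = fact k * exp ((c + 1) * \<bar>x\<bar> - s * x\<^sup>2)"
    by (simp add: exp_add[symmetric] algebra_simps)
  also have "\<dots> \<le> fact k * exp ((c + 1)\<^sup>2 / (2 * s) + - (s / 2) * x\<^sup>2)"
  proof -
    \<comment> \<open>Completing the square absorbs the linear exponent at the cost of half the
      quadratic decay.\<close>
    have "0 \<le> (s * \<bar>x\<bar> - (c + 1))\<^sup>2 / (2 * s)" using s by simp
    also have "\<dots> = (c + 1)\<^sup>2 / (2 * s) + (s / 2) * x\<^sup>2 - (c + 1) * \<bar>x\<bar>"
      using s by (simp add: field_simps power2_eq_square)
    finally show ?thesis by (simp add: field_simps)
  qed
  finally show ?thesis by (simp only: exp_add mult.assoc)
qed

lemma gaussian_integral_real: "has_bochner_integral lborel (\<lambda>x::real. exp (- x\<^sup>2)) (sqrt pi)"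
  using has_bochner_integral_even_function[OF gaussian_moment_0] by simp

lemma integrable_exp_neg_square:
  assumes "s > (0::real)"
  shows "integrable lborel (\<lambda>x::real. exp (- s * x\<^sup>2))"
proof -
  have "integrable lborel (\<lambda>x::real. exp (- (0 + sqrt s * x)\<^sup>2))"
    using assms gaussian_integral_real
    by (intro lborel_integrable_real_affine) (auto simp: has_bochner_integral_iff)
  thus ?thesis using assms by (simp add: power_mult_distrib)
qed

lemma integrable_of_gaussian_bound:
  fixes f :: "real \<Rightarrow> 'b :: {banach, second_countable_topology}"
  assumes "s > 0" "f \<in> borel_measurable lborel"
    and "\<And>x. norm (f x) \<le> \<bar>x\<bar> ^ k * exp (c * \<bar>x\<bar> - s * x\<^sup>2)"
  shows "integrable lborel f"
proof (rule Bochner_Integration.integrable_bound)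
  show "integrable lborel (\<lambda>x::real. fact k * exp ((c + 1)\<^sup>2 / (2 * s)) * exp (- (s / 2) * x\<^sup>2))"
    using integrable_exp_neg_square[of "s / 2"] assms(1) by simp
  show "AE x in lborel. norm (f x) \<le> norm (fact k * exp ((c + 1)\<^sup>2 / (2 * s)) * exp (- (s / 2) * x\<^sup>2))"
    using assms(3) power_exp_le_gaussian[OF assms(1), of _ k c] by (auto intro: order.trans)
qed fact

text \<open>The linear term encodes the centre: \<open>exp (- m * (x - w)^2)\<close> is
  \<open>exp (- m * w^2)\<close> times this weight with \<open>\<beta> = 2 * m * w\<close>.\<close>

definition gauss_moment :: "complex \<Rightarrow> complex \<Rightarrow> nat \<Rightarrow> complex" where
  "gauss_moment m \<beta> k = (\<integral>x. of_real x ^ k * exp (- m * of_real x ^ 2 + \<beta> * of_real x) \<partial>lborel)"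

lemma norm_gaussian_le:
  "norm (complex_of_real x ^ k * exp (- m * of_real x ^ 2 + \<beta> * of_real x))
     \<le> \<bar>x\<bar> ^ k * exp (norm \<beta> * \<bar>x\<bar> - Re m * x\<^sup>2)"
proof -
  have "Re (\<beta> * of_real x) \<le> norm \<beta> * \<bar>x\<bar>"
    using complex_Re_le_cmod[of "\<beta> * of_real x"] by (simp add: norm_mult)
  moreover have "Re (m * of_real x ^ 2) = Re m * x\<^sup>2"
    by (simp flip: of_real_power)
  ultimately show ?thesis
    by (auto simp: norm_mult norm_power intro!: mult_left_mono)
qed

lemma integrable_gauss_moment:
  assumes "Re m > 0"
  shows "integrable lborel (\<lambda>x. complex_of_real x ^ k * exp (- m * of_real x ^ 2 + \<beta> * of_real x))"
  using integrable_of_gaussian_bound[OF assms _ norm_gaussian_le] by simp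

lemma gaussian_tendsto_0:
  assumes m: "Re m > 0"
  shows "((\<lambda>x. complex_of_real x ^ k * exp (- m * of_real x ^ 2 + \<beta> * of_real x)) \<longlongrightarrow> 0) at_infinity"
proof (rule Lim_null_comparison)
  show "\<forall>\<^sub>F x in at_infinity. norm (complex_of_real x ^ k * exp (- m * of_real x ^ 2 + \<beta> * of_real x)) \<le>
    fact k * exp ((norm \<beta> + 1)\<^sup>2 / (2 * Re m)) * exp (- (Re m / 2) * x\<^sup>2)"
    using norm_gaussian_le power_exp_le_gaussian[OF m] by (intro always_eventually allI) (rule order.trans)
  have "filterlim (\<lambda>x::real. - (Re m / 2) * x\<^sup>2) at_bot at_infinity"
    using m unfolding at_infinity_eq_at_top_bot
    by (intro filterlim_sup) real_asymp+
  from filterlim_compose[OF exp_at_bot this]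
  show "((\<lambda>x::real. fact k * exp ((norm \<beta> + 1)\<^sup>2 / (2 * Re m)) * exp (- (Re m / 2) * x\<^sup>2)) \<longlongrightarrow> 0) at_infinity"
    by (rule tendsto_mult_right_zero)
qed

text \<open>Integration by parts: the derivative of \<open>x^k\<close> times the weight integrates
  to 0, as the boundary values vanish. At \<open>k = 0\<close> the truncated index
  \<open>k - 1\<close> carries the factor 0.\<close>

lemma gauss_moment_Suc:
  assumes m: "Re m > 0"
  shows "2 * m * gauss_moment m \<beta> (Suc k) = of_nat k * gauss_moment m \<beta> (k - 1) + \<beta> * gauss_moment m \<beta> k"
proof -
  define F where "F x = complex_of_real x ^ k * exp (- m * of_real x ^ 2 + \<beta> * of_real x)" for x
  define f where "f x = of_nat k * (complex_of_real x ^ (k - 1) * exp (- m * of_real x ^ 2 + \<beta> * of_real x))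
      + \<beta> * (complex_of_real x ^ k * exp (- m * of_real x ^ 2 + \<beta> * of_real x))
      - 2 * m * (complex_of_real x ^ Suc k * exp (- m * of_real x ^ 2 + \<beta> * of_real x))" for x
  have int: "integrable lborel f"
    unfolding f_def using integrable_gauss_moment[OF m] by (intro Bochner_Integration.integrable_add Bochner_Integration.integrable_diff integrable_mult_right)
  have lim: "(F \<longlongrightarrow> 0) at_top" "(F \<longlongrightarrow> 0) at_bot"
    using gaussian_tendsto_0[OF m, of k \<beta>] at_top_le_at_infinity at_bot_le_at_infinity
    unfolding F_def by (auto intro: tendsto_mono)
  have "(LBINT x=-\<infinity>..\<infinity>. f x) = 0 - 0"
  proof (rule interval_integral_FTC_integrable[where F = F])
    fix x :: real
    have "((\<lambda>z. z ^ k * exp (- m * z ^ 2 + \<beta> * z)) has_field_derivative f x) (at (of_real x))"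
      unfolding f_def by (auto intro!: derivative_eq_intros simp: algebra_simps)
    thus "(F has_vector_derivative f x) (at x)"
      unfolding F_def using has_vector_derivative_real_field by fastforce
    show "isCont f x" unfolding f_def by (intro continuous_intros)
  next
    show "set_integrable lborel (einterval (- \<infinity>) \<infinity>) f"
      using int by (simp add: set_integrable_def)
  qed (use lim in \<open>auto simp: ereal_tendsto_simps1\<close>)
  moreover have "(LBINT x=-\<infinity>..\<infinity>. f x) = (\<integral>x. f x \<partial>lborel)"
    by (simp add: interval_lebesgue_integral_def set_lebesgue_integral_def)
  moreover have "(\<integral>x. f x \<partial>lborel) = of_nat k * gauss_moment m \<beta> (k - 1) + \<beta> * gauss_moment m \<beta> k - 2 * m * gauss_moment m \<beta> (Suc k)"
    unfolding f_def gauss_moment_def using integrable_gauss_moment[OF m]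
    by (subst Bochner_Integration.integral_diff Bochner_Integration.integral_add; (intro Bochner_Integration.integrable_add integrable_mult_right)?; simp del: power_Suc)+
  ultimately show ?thesis by simp
qed

text \<open>Differentiating in \<open>m\<close> brings down \<open>- x^2\<close>, and the moment
  recurrence at \<open>k = 1\<close> reduces the second moment to the zeroth.\<close>

lemma gauss_moment_0_deriv_coeff:
  assumes "Re m > 0"
  shows "((\<lambda>m. gauss_moment m 0 0) has_field_derivative - (gauss_moment m 0 0 / (2 * m))) (at m)"
proof -
  have m0: "m \<noteq> 0" using assms by auto
  define f where "f x = exp (- m * complex_of_real x ^ 2)" for x :: real
  define u where "u x = - (complex_of_real x ^ 2)" for x :: real
  have u: "norm (u x) = x\<^sup>2" for x by (simp add: u_def norm_power)
  have f: "norm (f x) = exp (- Re m * x\<^sup>2)" for x by (simp add: f_def flip: of_real_power)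
  have "((\<lambda>h. \<integral>x. exp (h * u x) * f x \<partial>lborel) has_field_derivative (\<integral>x. u x * f x \<partial>lborel)) (at 0)"
  \<comment> \<open>This radius leaves half of the decay: \<open>exp (r * x^2)\<close> competes with
    \<open>exp (- Re m * x^2)\<close>.\<close>
  proof (rule has_field_derivative_integral_exp[where r = "Re m / 2"])
    show "integrable lborel f" "integrable lborel (\<lambda>x. u x * f x)"
      using integrable_gauss_moment[OF assms, of 0 0] integrable_gauss_moment[OF assms, of 2 0]
      by (simp_all add: f_def[abs_def] u_def)
    show "integrable lborel (\<lambda>x. exp (Re m / 2 * norm (u x)) * (norm (u x))\<^sup>2 * norm (f x))"
    proof (rule integrable_of_gaussian_bound[where s = "Re m / 2" and k = 4 and c = 0])
      show "norm (exp (Re m / 2 * norm (u x)) * (norm (u x))\<^sup>2 * norm (f x))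
          \<le> \<bar>x\<bar> ^ 4 * exp (0 * \<bar>x\<bar> - Re m / 2 * x\<^sup>2)" for x
        unfolding u f by (simp add: field_simps flip: exp_add power_mult)
    qed (use assms in \<open>auto simp: u_def[abs_def] f_def[abs_def]\<close>)
  qed (use assms in \<open>auto simp: u_def[abs_def] f_def[abs_def]\<close>)
  moreover have "(\<lambda>h. \<integral>x. exp (h * u x) * f x \<partial>lborel) = (\<lambda>h. gauss_moment (h + m) 0 0)"
    by (simp add: gauss_moment_def u_def f_def algebra_simps flip: exp_add)
  moreover have "(\<integral>x. u x * f x \<partial>lborel) = - gauss_moment m 0 2"
    by (simp add: gauss_moment_def u_def f_def)
  moreover have "gauss_moment m 0 2 = gauss_moment m 0 0 / (2 * m)"
    using gauss_moment_Suc[OF assms, of 0 1] m0 by (simp add: field_simps numeral_2_eq_2)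
  ultimately show ?thesis
    using DERIV_shift[of "\<lambda>m. gauss_moment m 0 0" _ 0 m] by simp
qed

lemma gauss_moment_0_deriv_shift:
  assumes "Re m > 0"
  shows "((\<lambda>\<beta>. gauss_moment m \<beta> 0) has_field_derivative (\<beta> / (2 * m) * gauss_moment m \<beta> 0)) (at \<beta>)"
proof -
  have m0: "m \<noteq> 0" using assms by auto
  define f where "f x = exp (- m * complex_of_real x ^ 2 + \<beta> * complex_of_real x)" for x :: real
  have f: "norm (f x) \<le> exp (norm \<beta> * \<bar>x\<bar> - Re m * x\<^sup>2)" for x
    using norm_gaussian_le[of x 0 m \<beta>] by (simp add: f_def)
  have "((\<lambda>h. \<integral>x. exp (h * complex_of_real x) * f x \<partial>lborel) has_field_derivative (\<integral>x. complex_of_real x * f x \<partial>lborel)) (at 0)"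
  proof (rule has_field_derivative_integral_exp[where r = 1])
    show "integrable lborel f" "integrable lborel (\<lambda>x. complex_of_real x * f x)"
      using integrable_gauss_moment[OF assms, of 0 \<beta>] integrable_gauss_moment[OF assms, of 1 \<beta>]
      by (simp_all add: f_def[abs_def])
    show "integrable lborel (\<lambda>x. exp (1 * norm (complex_of_real x)) * (norm (complex_of_real x))\<^sup>2 * norm (f x))"
    proof (rule integrable_of_gaussian_bound[where s = "Re m" and k = 2 and c = "norm \<beta> + 1"])
      fix x :: real
      have "norm (exp (1 * norm (complex_of_real x)) * (norm (complex_of_real x))\<^sup>2 * norm (f x))
          \<le> exp \<bar>x\<bar> * \<bar>x\<bar>\<^sup>2 * exp (norm \<beta> * \<bar>x\<bar> - Re m * x\<^sup>2)"
        using f[of x] by (simp add: mult_left_mono)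
      also have "\<dots> = \<bar>x\<bar> ^ 2 * exp ((norm \<beta> + 1) * \<bar>x\<bar> - Re m * x\<^sup>2)"
        by (simp add: algebra_simps flip: exp_add)
      finally show "norm (exp (1 * norm (complex_of_real x)) * (norm (complex_of_real x))\<^sup>2 * norm (f x))
          \<le> \<bar>x\<bar> ^ 2 * exp ((norm \<beta> + 1) * \<bar>x\<bar> - Re m * x\<^sup>2)" .
    qed (use assms in \<open>auto simp: f_def[abs_def]\<close>)
  qed (use assms in \<open>auto simp: f_def[abs_def]\<close>)
  moreover have "(\<lambda>h. \<integral>x. exp (h * complex_of_real x) * f x \<partial>lborel) = (\<lambda>h. gauss_moment m (h + \<beta>) 0)"
    by (simp add: gauss_moment_def f_def algebra_simps flip: exp_add)
  moreover have "(\<integral>x. complex_of_real x * f x \<partial>lborel) = gauss_moment m \<beta> 1"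
    by (simp add: gauss_moment_def f_def)
  moreover have "gauss_moment m \<beta> 1 = \<beta> / (2 * m) * gauss_moment m \<beta> 0"
    using gauss_moment_Suc[OF assms, of \<beta> 0] m0 by (simp add: field_simps)
  ultimately show ?thesis
    using DERIV_shift[of "\<lambda>\<beta>. gauss_moment m \<beta> 0" _ 0 \<beta>] by simp
qed

text \<open>
  Both \<open>M(m, \<beta>) exp (- \<beta>\<^sup>2 / (4 m))\<close> as a function of \<open>\<beta>\<close> and \<open>M(m, 0) sqrt m\<close> as a function of \<open>m\<close> in
  the right half plane have derivative 0; the latter form also selects the branch of the root.
\<close>

lemma gauss_moment_0:
  assumes m: "Re m > 0"
  shows "gauss_moment m \<beta> 0 = of_real (sqrt pi) / csqrt m * exp (\<beta>\<^sup>2 / (4 * m))"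
proof -
  have m0: "m \<noteq> 0" using m by auto
  have "\<exists>c. \<forall>\<beta>\<in>UNIV. gauss_moment m \<beta> 0 * exp (- (\<beta>\<^sup>2 / (4 * m))) = c"
  proof (rule has_field_derivative_zero_constant)
    show "((\<lambda>\<beta>. gauss_moment m \<beta> 0 * exp (- (\<beta>\<^sup>2 / (4 * m)))) has_field_derivative 0) (at \<beta> within UNIV)" for \<beta>
      using m0 by (auto intro!: derivative_eq_intros gauss_moment_0_deriv_shift[OF m] simp: field_simps)
  qed auto
  then obtain c where "gauss_moment m \<beta> 0 * exp (- (\<beta>\<^sup>2 / (4 * m))) = c" for \<beta> by auto
  from this[of \<beta>] this[of 0] have 1: "gauss_moment m \<beta> 0 = gauss_moment m 0 0 * exp (\<beta>\<^sup>2 / (4 * m))"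
    by (simp add: exp_minus field_simps)
  have "\<exists>c. \<forall>m\<in>{z. Re z > 0}. gauss_moment m 0 0 * csqrt m = c"
  proof (rule has_field_derivative_zero_constant)
    fix z assume z: "z \<in> {z. Re z > 0}"
    \<comment> \<open>The right half plane avoids the branch cut, so \<open>csqrt\<close> is
      differentiable there.\<close>
    hence "z \<notin> \<real>\<^sub>\<le>\<^sub>0" "z \<noteq> 0" by (auto simp: complex_nonpos_Reals_iff)
    moreover have "csqrt z * csqrt z = z" by (metis power2_csqrt power2_eq_square)
    ultimately show "((\<lambda>z. gauss_moment z 0 0 * csqrt z) has_field_derivative 0) (at z within {z. Re z > 0})"
      using z
      by (auto intro!: derivative_eq_intros DERIV_subset[OF gauss_moment_0_deriv_coeff] simp: field_simps)
  qed (auto simp: convex_halfspace_Re_gt)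
  then obtain c where c: "\<And>z. Re z > 0 \<Longrightarrow> gauss_moment z 0 0 * csqrt z = c" by blast
  \<comment> \<open>The constant is read off at \<open>m = 1\<close>, where \<open>csqrt\<close> is
    1 and the integral is the real Gaussian one.\<close>
  have "gauss_moment 1 0 0 = of_real (\<integral>x. exp (- x\<^sup>2) \<partial>lborel)"
    unfolding gauss_moment_def by (simp flip: integral_complex_of_real exp_of_real)
  hence "c = of_real (sqrt pi)"
    using c[of 1] gaussian_integral_real by (simp add: has_bochner_integral_iff)
  with c[OF m] m0 have "gauss_moment m 0 0 = of_real (sqrt pi) / csqrt m" by (simp add: field_simps)
  with 1 show ?thesis by simp
qed

section \<open>Heat polynomials\<close>

text \<open>\<open>heat_poly s n\<close> is \<open>exp (s D\<^sup>2) x\<^sup>n\<close>, and \<open>heat s\<close> below is the operator \<open>exp (s D\<^sup>2)\<close>.\<close>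

fun heat_poly :: "'a :: comm_ring_1 \<Rightarrow> nat \<Rightarrow> 'a poly" where
  "heat_poly s 0 = 1"
| "heat_poly s (Suc 0) = [:0, 1:]"
| "heat_poly s (Suc (Suc n)) = [:0, 1:] * heat_poly s (Suc n) + smult (2 * s * of_nat (Suc n)) (heat_poly s n)"

lemma heat_poly_Suc:
  "heat_poly s (Suc n) = [:0, 1:] * heat_poly s n + smult (2 * s * of_nat n) (heat_poly s (n - 1))"
  by (cases n) auto

text \<open>The Appell property: \<open>D\<close> commutes with the heat operator.\<close>

lemma pderiv_heat_poly: "pderiv (heat_poly s n) = smult (of_nat n) (heat_poly s (n - 1))"
proof (induction s n rule: heat_poly.induct)
  case (3 s n)
  have "pderiv (heat_poly s (Suc (Suc n))) = heat_poly s (Suc n)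
      + smult (of_nat (Suc n)) ([:0, 1:] * heat_poly s n + smult (2 * s * of_nat n) (heat_poly s (n - 1)))"
    unfolding heat_poly.simps(3) pderiv_add pderiv_mult pderiv_smult 3
    by (simp add: pderiv_pCons smult_add_right mult_ac add_ac)
  also have "\<dots> = smult (of_nat (Suc (Suc n))) (heat_poly s (Suc n))"
    unfolding heat_poly_Suc[symmetric] of_nat_Suc[of "Suc n"] smult_add_left by simp
  finally show ?case by simp
qed (auto simp: pderiv_pCons)

lemma poly_heat_poly_scale:
  fixes r :: "'a :: comm_ring_1"
  shows "poly (heat_poly (r\<^sup>2 * s) n) (r * x) = r ^ n * poly (heat_poly s n) x"
  by (induction s n rule: heat_poly.induct) (auto simp: algebra_simps power2_eq_square)

text \<open>The heat flow fixes degrees below 2. This covers the small \<open>n\<close> for which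
  \<open>\<delta>\<close> may vanish.\<close>

lemma heat_poly_less_2: "n < 2 \<Longrightarrow> heat_poly s n = heat_poly t n"
  by (cases n) auto

lemma poly_heat_poly_of_real:
  "poly (heat_poly (of_real s) n) (of_real x) = (of_real (poly (heat_poly s n) x) :: 'a :: {comm_ring_1, real_algebra_1})"
  by (induction s n rule: heat_poly.induct) auto

section \<open>Coefficients of heat polynomials\<close>

lemma coeff_heat_poly_gt: "n < j \<Longrightarrow> coeff (heat_poly s n) j = 0"
proof (induction s n arbitrary: j rule: heat_poly.induct)
  case (3 s n)
  thus ?case by (cases j) auto
qed (auto simp: coeff_pCons split: nat.splits)

lemma degree_heat_poly_le: "degree (heat_poly s n) \<le> n"
  by (intro degree_le) (auto simp: coeff_heat_poly_gt)

lemma coeff_heat_poly_self [simp]: "coeff (heat_poly s n) n = 1"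
  by (induction s n rule: heat_poly.induct) (auto simp: coeff_heat_poly_gt)

lemma coeff_heat_poly_Suc:
  fixes s :: "'a :: idom"
  shows "of_nat (Suc j) * coeff (heat_poly s (Suc n)) (Suc j) = of_nat (Suc n) * coeff (heat_poly s n) j"
  using arg_cong[OF pderiv_heat_poly[of s "Suc n"], of "\<lambda>p. coeff p j"] by (simp add: coeff_pderiv)

text \<open>Iterating the Appell property reduces every coefficient to a constant term, with a
  binomial factor written here without division.\<close>

lemma coeff_heat_poly_add:
  fixes s :: "'a :: {idom, ring_char_0}"
  shows "fact j * fact m * coeff (heat_poly s (j + m)) j = fact (j + m) * coeff (heat_poly s m) 0"
proof (induction j)
  case (Suc j)
  have "fact (Suc j) * fact m * coeff (heat_poly s (Suc j + m)) (Suc j)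
      = fact j * fact m * (of_nat (Suc j) * coeff (heat_poly s (Suc (j + m))) (Suc j))"
    by (simp add: mult_ac)
  also have "\<dots> = of_nat (Suc (j + m)) * (fact j * fact m * coeff (heat_poly s (j + m)) j)"
    unfolding coeff_heat_poly_Suc by (simp add: mult_ac)
  finally show ?case using Suc by (simp add: mult_ac)
qed simp

text \<open>At \<open>x = 0\<close> only the term \<open>s^k D^(2 k) / k!\<close> of the operator
  survives on \<open>x^(2 k)\<close>; the proof evaluates the recurrence at 0.\<close>

lemma coeff_heat_poly_0:
  fixes s :: "'a :: {idom, ring_char_0}"
  shows "fact k * coeff (heat_poly s (2 * k)) 0 = fact (2 * k) * s ^ k"
    and "coeff (heat_poly s (Suc (2 * k))) 0 = 0"
proof (induction k)
  case (Suc k)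
  {
    case 1
    have "fact (Suc k) * coeff (heat_poly s (2 * Suc k)) 0
        = of_nat (Suc k) * (2 * s * of_nat (Suc (2 * k))) * (fact k * coeff (heat_poly s (2 * k)) 0)"
      by (simp add: mult_ac del: of_nat_Suc)
    also have "\<dots> = fact (2 * Suc k) * s ^ Suc k"
      unfolding Suc by (simp add: algebra_simps)
    finally show ?case .
  next
    case 2
    show ?case using Suc by simp
  }
qed auto

lemma coeff_heat_poly_odd:
  fixes s :: "'a :: field_char_0"
  assumes "2 * k + 1 \<le> n"
  shows "coeff (heat_poly s n) (n - (2 * k + 1)) = 0"
  using coeff_heat_poly_add[of "n - (2 * k + 1)" "2 * k + 1" s] assms coeff_heat_poly_0(2)[of s k]
  by (simp del: fact_Suc)

lemma coeff_heat_poly_even: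
  fixes s :: "'a :: field_char_0"
  assumes "2 * k \<le> n"
  shows "coeff (heat_poly s n) (n - 2 * k) = s ^ k * fact n / (fact k * fact (n - 2 * k))"
proof -
  have "fact (2 * k) * (fact k * fact (n - 2 * k) * coeff (heat_poly s n) (n - 2 * k))
      = fact n * (fact k * coeff (heat_poly s (2 * k)) 0)"
    using coeff_heat_poly_add[of "n - 2 * k" "2 * k" s] assms by (simp add: mult_ac)
  hence "fact k * fact (n - 2 * k) * coeff (heat_poly s n) (n - 2 * k) = fact n * s ^ k"
    unfolding coeff_heat_poly_0 by (simp add: mult_ac)
  thus ?thesis by (simp add: field_simps)
qed

lemma heat_poly_explicit:
  fixes s :: "'a :: field_char_0"
  shows "heat_poly s n = (\<Sum>k\<le>n div 2. monom (s ^ k * fact n / (fact k * fact (n - 2 * k))) (n - 2 * k))"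
proof -
  have "heat_poly s n = (\<Sum>j\<le>n. monom (coeff (heat_poly s n) j) j)"
    using poly_as_sum_of_monoms'[OF degree_heat_poly_le[of s n]] by simp
  also have "\<dots> = (\<Sum>j\<in>(\<lambda>k. n - 2 * k) ` {..n div 2}. monom (coeff (heat_poly s n) j) j)"
  proof (intro sum.mono_neutral_right ballI)
    fix j assume j: "j \<in> {..n} - (\<lambda>k. n - 2 * k) ` {..n div 2}"
    have "odd (n - j)"
    proof
      assume "even (n - j)"
      then obtain k where "n - j = 2 * k" by blast
      with j have "j = n - 2 * k" "k \<le> n div 2" by auto
      with j show False by auto
    qed
    then obtain k where "n - j = 2 * k + 1" by (rule oddE)
    with j have "j = n - (2 * k + 1)" "2 * k + 1 \<le> n" by auto
    thus "monom (coeff (heat_poly s n) j) j = 0"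
      using coeff_heat_poly_odd[of k n s] by simp
  qed auto
  also have "\<dots> = (\<Sum>k\<le>n div 2. monom (coeff (heat_poly s n) (n - 2 * k)) (n - 2 * k))"
    by (subst sum.reindex) (auto simp: inj_on_def)
  also have "\<dots> = (\<Sum>k\<le>n div 2. monom (s ^ k * fact n / (fact k * fact (n - 2 * k))) (n - 2 * k))"
    by (intro sum.cong) (auto simp: coeff_heat_poly_even)
  finally show ?thesis .
qed

section \<open>The heat operator and its semigroup law\<close>

definition heat :: "'a :: comm_ring_1 \<Rightarrow> 'a poly \<Rightarrow> 'a poly" where
  "heat s P = (\<Sum>j\<le>degree P. smult (coeff P j) (heat_poly s j))"

text \<open>Padding with zero coefficients gives polynomials of different degrees a common summation
  range.\<close>

lemma heat_eq: "degree P \<le> N \<Longrightarrow> heat s P = (\<Sum>j\<le>N. smult (coeff P j) (heat_poly s j))"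
  unfolding heat_def by (intro sum.mono_neutral_left) (auto simp: coeff_eq_0 not_le)

lemma smult_sum_right: "smult c (\<Sum>i\<in>A. f i) = (\<Sum>i\<in>A. smult c (f i))"
  by (induction A rule: infinite_finite_induct) (auto simp: smult_add_right)

lemma heat_add: "heat s (P + Q) = heat s P + heat s Q"
proof -
  define N where "N = max (degree P) (degree Q)"
  have "degree (P + Q) \<le> N" "degree P \<le> N" "degree Q \<le> N"
    unfolding N_def by (auto intro: degree_add_le)
  thus ?thesis by (simp add: heat_eq[of _ N] smult_add_left sum.distrib)
qed

lemma heat_smult: "heat s (smult c P) = smult c (heat s P)"
  using heat_eq[of "smult c P" "degree P" s]
  by (simp add: degree_smult_le heat_def smult_sum_right)

text \<open>The commutator of \<open>D^2\<close> and multiplication by \<open>x\<close> is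
  \<open>2 D\<close>, so moving the heat operator past \<open>x\<close> costs
  \<open>2 s D\<close>.\<close>

lemma heat_shift: "heat s ([:0, 1:] * P) = [:0, 1:] * heat s P + smult (2 * s) (heat s (pderiv P))"
proof -
  define N where "N = degree P"
  have 1: "degree ([:0, 1:] * P) \<le> Suc N" unfolding N_def by (simp add: degree_pCons_le)
  have 2: "degree (pderiv P) \<le> N" unfolding N_def
    by (intro degree_le) (auto simp: coeff_pderiv coeff_eq_0)
  have "heat s ([:0, 1:] * P) = (\<Sum>j\<le>N. smult (coeff P j) (heat_poly s (Suc j)))"
    unfolding heat_eq[OF 1] by (subst sum.atMost_Suc_shift) simp
  also have "\<dots> = [:0, 1:] * (\<Sum>j\<le>N. smult (coeff P j) (heat_poly s j)) +
      smult (2 * s) (\<Sum>j\<le>N. smult (coeff P j * of_nat j) (heat_poly s (j - 1)))"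
    by (simp add: heat_poly_Suc sum_distrib_left smult_sum_right sum.distrib[symmetric] smult_add_right algebra_simps)
  also have "(\<Sum>j\<le>N. smult (coeff P j * of_nat j) (heat_poly s (j - 1))) = heat s (pderiv P)"
  proof -
    \<comment> \<open>The added top coefficient is 0, and so is the term \<open>j = 0\<close>, where
      \<open>j - 1\<close> truncates; the sum can therefore be shifted by one.\<close>
    have "(\<Sum>j\<le>N. smult (coeff P j * of_nat j) (heat_poly s (j - 1))) = (\<Sum>j\<le>Suc N. smult (coeff P j * of_nat j) (heat_poly s (j - 1)))"
      by (simp add: N_def coeff_eq_0)
    also have "\<dots> = (\<Sum>j\<le>N. smult (coeff P (Suc j) * of_nat (Suc j)) (heat_poly s j))"
      by (subst sum.atMost_Suc_shift) simp
    finally show ?thesis by (simp add: heat_eq[OF 2] coeff_pderiv mult.commute)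
  qed
  finally show ?thesis by (simp add: heat_def N_def)
qed

text \<open>Semigroup law: the \<open>2 * s\<close> from commuting past \<open>x\<close> adds to the
  \<open>2 * t\<close> of the recurrence.\<close>

lemma heat_heat_poly:
  fixes s t :: "'a :: idom"
  shows "heat s (heat_poly t n) = heat_poly (s + t) n"
proof (induction t n rule: heat_poly.induct)
  case (3 t n)
  have "heat s (heat_poly t (Suc (Suc n))) = [:0, 1:] * heat_poly (s + t) (Suc n) +
     (smult (2 * s) (smult (of_nat (Suc n)) (heat_poly (s + t) n)) + smult (2 * t * of_nat (Suc n)) (heat_poly (s + t) n))"
    by (simp only: 3 heat_poly.simps heat_add heat_smult heat_shift pderiv_heat_poly diff_Suc_1 add.assoc)
  also have "(smult (2 * s) (smult (of_nat (Suc n)) (heat_poly (s + t) n)) + smult (2 * t * of_nat (Suc n)) (heat_poly (s + t) n))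
      = smult (2 * (s + t) * of_nat (Suc n)) (heat_poly (s + t) n)"
    by (simp only: smult_smult smult_add_left[symmetric] distrib_left distrib_right)
  finally show ?case by (simp only: heat_poly.simps)
qed (auto simp: heat_def)

text \<open>\<open>D^2\<close> lowers degrees, so only the identity term of the operator reaches the
  top coefficient.\<close>

lemma coeff_heat_degree: "coeff (heat s P) (degree P) = lead_coeff P"
proof -
  have "coeff (heat s P) (degree P) = (\<Sum>j\<le>degree P. if j = degree P then lead_coeff P else 0)"
    unfolding heat_def coeff_sum by (intro sum.cong) (auto simp: coeff_heat_poly_gt)
  thus ?thesis by simp
qed

text \<open>Also true for \<open>d = 0\<close>, where both \<open>1 / d\<close> and the parameter on the right are 0.\<close>

lemma herm_rec_eq: "herm_rec d C n = smult (C * 2 ^ n) (heat_poly (- 1 / (4 * d)) n)"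
proof (induction n)
  case (Suc n)
  have 1: "[:0, 2:] = smult 2 [:0, 1 :: complex:]" by simp
  show ?case
    unfolding herm_rec.simps Suc heat_poly_Suc 1
    by (simp add: pderiv_smult pderiv_heat_poly smult_add_right mult_ac add_ac flip: smult_minus_left)
qed simp

lemma hermite_fun_eq: "hermite_fun n x = 2 ^ n * poly (heat_poly (- 1 / 4) n) x"
proof -
  \<comment> \<open>Differentiating the Gaussian gives the factor \<open>-2 t\<close>, and the
    polynomial contributes its derivative; taking out \<open>-2\<close> leaves the heat recurrence
    with \<open>s = - 1 / 4\<close>.\<close>
  have "(deriv ^^ n) (\<lambda>t::real. exp (- (t\<^sup>2))) = (\<lambda>t. (- 2) ^ n * poly (heat_poly (- 1 / 4) n) t * exp (- t\<^sup>2))"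
  proof (induction n)
    case (Suc n)
    have "((\<lambda>t. (- 2) ^ n * poly (heat_poly (- 1 / 4) n) t * exp (- t\<^sup>2)) has_real_derivative
        (- 2) ^ Suc n * poly (heat_poly (- 1 / 4) (Suc n)) t * exp (- t\<^sup>2)) (at t)" for t :: real
      unfolding heat_poly_Suc
      by (auto intro!: derivative_eq_intros simp: pderiv_heat_poly algebra_simps)
    thus ?case by (auto simp: Suc intro: DERIV_imp_deriv)
  qed simp
  hence "hermite_fun n x = ((- 1) ^ n * (- 2) ^ n) * (exp (x\<^sup>2) * exp (- x\<^sup>2)) * poly (heat_poly (- 1 / 4) n) x"
    by (simp add: hermite_fun_def)
  also have "((- 1) ^ n * (- 2) ^ n :: real) = 2 ^ n"
    by (simp flip: power_mult_distrib)
  finally show ?thesis by (simp flip: exp_add)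
qed

section \<open>Proportional Gaussian transforms\<close>

text \<open>With \<open>\<beta> = 2 * m * w\<close> the moment recurrence, divided by
  \<open>2 * m\<close>, is the heat recurrence at \<open>s = 1 / (4 * m)\<close>; the closed form of
  the zeroth moment starts the induction.\<close>

lemma gauss_moment_heat_poly:
  assumes m: "Re m > 0"
  shows "exp (- m * w\<^sup>2) * gauss_moment m (2 * m * w) k = of_real (sqrt pi) / csqrt m * poly (heat_poly (1 / (4 * m)) k) w"
proof (induction k rule: less_induct)
  case (less k)
  have m0: "m \<noteq> 0" using m by auto
  show ?case
  proof (cases k)
    case 0
    have "(2 * m * w)\<^sup>2 / (4 * m) = m * w\<^sup>2"
      using m0 by (simp add: field_simps power2_eq_square)
    hence "exp (- m * w\<^sup>2) * gauss_moment m (2 * m * w) 0 = of_real (sqrt pi) / csqrt m * exp (- m * w\<^sup>2 + m * w\<^sup>2)"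
      unfolding gauss_moment_0[OF m] exp_add by simp
    with 0 show ?thesis by simp
  next
    case (Suc j)
    have "gauss_moment m (2 * m * w) (Suc j) =
        w * gauss_moment m (2 * m * w) j + of_nat j / (2 * m) * gauss_moment m (2 * m * w) (j - 1)"
      using gauss_moment_Suc[OF m, of "2 * m * w" j] m0 by (simp add: field_simps)
    hence "exp (- m * w\<^sup>2) * gauss_moment m (2 * m * w) k =
        w * (exp (- m * w\<^sup>2) * gauss_moment m (2 * m * w) j)
        + of_nat j / (2 * m) * (exp (- m * w\<^sup>2) * gauss_moment m (2 * m * w) (j - 1))"
      by (simp add: Suc algebra_simps)
    also have "\<dots> = of_real (sqrt pi) / csqrt m * poly (heat_poly (1 / (4 * m)) k) w"
      using less[of j] less[of "j - 1"] Suc by (simp add: heat_poly_Suc algebra_simps)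
    finally show ?thesis .
  qed
qed

lemma gauss_int_eq:
  assumes m: "Re m > 0"
  shows "gauss_int P m c z = of_real (sqrt pi) / csqrt m * poly (heat (1 / (4 * m)) P) (c * z)"
proof -
  define w where "w = c * z"
  define g where "g j x = of_real x ^ j * exp (- m * of_real x ^ 2 + 2 * m * w * of_real x)" for j and x :: real
  have "exp (- m * (of_real x - w)\<^sup>2) = exp (- m * w\<^sup>2) * exp (- m * of_real x ^ 2 + 2 * m * w * of_real x)" for x :: real
    unfolding exp_add[symmetric] by (simp add: power2_eq_square algebra_simps)
  hence "poly P (of_real x) * exp (- m * (of_real x - c * z)\<^sup>2)
      = (\<Sum>j\<le>degree P. coeff P j * exp (- m * w\<^sup>2) * g j x)" for x :: real
    unfolding poly_altdef g_def w_def[symmetric] sum_distrib_right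
    by (intro sum.cong refl) (simp only: mult_ac)
  moreover have "integrable lborel (g j)" for j
    using integrable_gauss_moment[OF m, of j "2 * m * w"] unfolding g_def .
  ultimately have "gauss_int P m c z = (\<Sum>j\<le>degree P. coeff P j * exp (- m * w\<^sup>2) * integral\<^sup>L lborel (g j))"
    unfolding gauss_int_def by (simp add: Bochner_Integration.integral_sum)
  also have "\<dots> = (\<Sum>j\<le>degree P. coeff P j * (of_real (sqrt pi) / csqrt m * poly (heat_poly (1 / (4 * m)) j) w))"
    unfolding gauss_moment_heat_poly[OF m, symmetric] gauss_moment_def g_def by (simp add: mult_ac)
  also have "\<dots> = of_real (sqrt pi) / csqrt m * poly (heat (1 / (4 * m)) P) w"
    by (simp add: heat_def poly_sum sum_distrib_left mult_ac)
  finally show ?thesis by (simp add: w_def)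
qed

lemma heat_proportional_coeff:
  fixes a b s t c :: "'a :: field_char_0"
  assumes "\<And>z. poly (heat s P) (a * z) = c * poly (heat t P) (b * z)"
  shows "a ^ j * coeff (heat s P) j = c * b ^ j * coeff (heat t P) j"
proof -
  have "pcompose (heat s P) [:0, a:] = smult c (pcompose (heat t P) [:0, b:])"
    by (rule poly_eq_poly_eq_iff[THEN iffD1], rule ext)
       (use assms in \<open>simp add: poly_pcompose mult.commute\<close>)
  from arg_cong[OF this, of "\<lambda>p. coeff p j"] show ?thesis
    by (simp add: coeff_pcompose_linear mult_ac)
qed

text \<open>The heat operator keeps the leading coefficient, so comparing coefficients at the degree
  of \<open>P\<close> determines \<open>c\<close>.\<close>

lemma heat_proportional_const:
  fixes a b s t c :: "'a :: field_char_0"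
  assumes "\<And>z. poly (heat s P) (a * z) = c * poly (heat t P) (b * z)" and "P \<noteq> 0" "b \<noteq> 0"
  shows "c = (a / b) ^ degree P"
  using heat_proportional_coeff[of s P a c t b "degree P"] assms
  by (simp add: coeff_heat_degree field_simps)

lemma heat_poly_proportional:
  fixes a b s t \<kappa> :: "'a :: field"
  assumes ab: "a \<noteq> 0" "b \<noteq> 0" and rel: "n < 2 \<or> b\<^sup>2 * (s + \<kappa>) = a\<^sup>2 * (t + \<kappa>)"
  shows "poly (heat s (heat_poly \<kappa> n)) (a * z) = (a / b) ^ n * poly (heat t (heat_poly \<kappa> n)) (b * z)"
proof -
  have "heat_poly (t + \<kappa>) n = heat_poly ((b / a)\<^sup>2 * (s + \<kappa>)) n"
    using rel
  proof
    assume "b\<^sup>2 * (s + \<kappa>) = a\<^sup>2 * (t + \<kappa>)"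
    hence "t + \<kappa> = (b / a)\<^sup>2 * (s + \<kappa>)"
      using ab by (simp add: field_simps)
    thus ?thesis by simp
  qed (rule heat_poly_less_2)
  \<comment> \<open>Scaling by \<open>b / a\<close> carries the point \<open>a * z\<close> to
    \<open>b * z\<close> and the parameter \<open>s + \<kappa>\<close> to
    \<open>t + \<kappa>\<close>.\<close>
  with poly_heat_poly_scale[of "b / a" "s + \<kappa>" n "a * z"] ab show ?thesis
    by (simp add: heat_heat_poly field_simps)
qed

lemma heat_proportional_unique:
  fixes a b s t \<kappa> c :: "'a :: field_char_0"
  assumes ab: "a \<noteq> 0" "b \<noteq> 0" and rel: "n < 2 \<or> b\<^sup>2 * (s + \<kappa>) = a\<^sup>2 * (t + \<kappa>)"
    and P: "P \<noteq> 0" "degree P = n"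
    and pow: "\<And>k. 1 \<le> k \<Longrightarrow> k \<le> n \<Longrightarrow> a ^ k \<noteq> b ^ k"
    and eq: "\<And>z. poly (heat s P) (a * z) = c * poly (heat t P) (b * z)"
  shows "P = smult (lead_coeff P) (heat_poly \<kappa> n)"
proof (rule ccontr)
  define R where "R = P + smult (- lead_coeff P) (heat_poly \<kappa> n)"
  assume "P \<noteq> smult (lead_coeff P) (heat_poly \<kappa> n)"
  hence R: "R \<noteq> 0" by (simp add: R_def)
  have "degree R \<le> n"
    using P degree_heat_poly_le[of \<kappa> n] unfolding R_def
    by (intro degree_add_le) (auto intro: degree_smult_le[THEN order.trans])
  moreover have "coeff R n = 0" using P by (simp add: R_def)
  ultimately have deg: "degree R < n"
    using R by (metis leading_coeff_0_iff order_le_less)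
  have c: "c = (a / b) ^ n"
    using heat_proportional_const[OF eq] P ab by simp
  have "poly (heat s R) (a * z) = c * poly (heat t R) (b * z)" for z
    using heat_poly_proportional[OF ab rel, of z] eq[of z]
    unfolding R_def heat_add heat_smult c by (simp add: algebra_simps)
  \<comment> \<open>\<open>R\<close> inherits the proportionality with the same \<open>c\<close>,
    which must then be the power of \<open>a / b\<close> for both degrees.\<close>
  from heat_proportional_const[OF this R ab(2)] have "(a / b) ^ n = (a / b) ^ degree R"
    by (simp add: c)
  also have "(a / b) ^ n = (a / b) ^ degree R * (a / b) ^ (n - degree R)"
    using deg by (simp flip: power_add)
  finally have "(a / b) ^ (n - degree R) = 1"
    using ab by simp
  hence "a ^ (n - degree R) = b ^ (n - degree R)"
    using ab by (simp add: power_divide)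
  with pow[of "n - degree R"] deg show False by linarith
qed

text \<open>With \<open>s = - 1 / (4 * d)\<close>, consecutive even coefficients have the ratio
  required because \<open>- 4 * d * s = 1\<close>. For \<open>n < 2\<close> the even recurrence is
  vacuous, so \<open>d\<close> may be 0.\<close>

lemma coeff_recurrence_iff:
  fixes P :: "complex poly"
  assumes deg: "degree P = n" and d: "n < 2 \<or> d \<noteq> 0"
  shows "(\<forall>k. 2 * k + 1 \<le> n \<longrightarrow> coeff P (n - (2 * k + 1)) = 0) \<and>
      (\<forall>k. 2 * k + 2 \<le> n \<longrightarrow>
         of_nat (fact (n - 2 * k)) * coeff P (n - 2 * k) =
         - 2 * d * of_nat (2 * k + 2) * of_nat (fact (n - 2 * k - 2)) * coeff P (n - (2 * k + 2)))
    \<longleftrightarrow> P = smult (lead_coeff P) (heat_poly (- 1 / (4 * d)) n)"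
    (is "?odd \<and> ?even \<longleftrightarrow> ?R")
proof
  assume *: "?odd \<and> ?even"
  have even: "coeff P (n - 2 * k) = lead_coeff P * coeff (heat_poly (- 1 / (4 * d)) n) (n - 2 * k)"
    if "2 * k \<le> n" for k
    using that
  proof (induction k)
    case (Suc k)
    hence k: "2 * k \<le> n" "2 * k + 2 \<le> n" and d0: "d \<noteq> 0" using d by auto
    have e: "n - 2 * k - 2 = n - 2 * Suc k" "n - (2 * k + 2) = n - 2 * Suc k"
      "(of_nat (2 * k + 2) :: complex) = 2 * of_nat (Suc k)" by auto
    have "of_nat (fact (n - 2 * k)) * coeff P (n - 2 * k) =
         - 2 * d * of_nat (2 * k + 2) * of_nat (fact (n - 2 * k - 2)) * coeff P (n - (2 * k + 2))"
      using * k(2) by blast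
    thus ?case
      unfolding Suc.IH[OF k(1)] coeff_heat_poly_even[OF k(1)] coeff_heat_poly_even[OF Suc.prems] e
      using d0 by (simp add: field_simps del: of_nat_Suc)
  qed (simp add: deg)
  show ?R
  proof (rule poly_eqI)
    fix j
    consider "j > n" | k where "j \<le> n" "n - j = 2 * k" | k where "j \<le> n" "n - j = 2 * k + 1"
      by (metis evenE oddE not_le)
    thus "coeff P j = coeff (smult (lead_coeff P) (heat_poly (- 1 / (4 * d)) n)) j"
    proof cases
      case 1
      thus ?thesis by (simp add: coeff_heat_poly_gt coeff_eq_0 deg)
    next
      case 2
      hence "j = n - 2 * k" "2 * k \<le> n" by auto
      thus ?thesis using even by simp
    next
      case 3
      hence "j = n - (2 * k + 1)" "2 * k + 1 \<le> n" by auto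
      thus ?thesis using * coeff_heat_poly_odd[of k n "- 1 / (4 * d)"] by simp
    qed
  qed
next
  assume ?R
  hence P: "coeff P j = lead_coeff P * coeff (heat_poly (- 1 / (4 * d)) n) j" for j
    by (metis coeff_smult)
  show "?odd \<and> ?even"
  proof (intro conjI allI impI)
    fix k assume k: "2 * k + 1 \<le> n"
    show "coeff P (n - (2 * k + 1)) = 0"
      unfolding P[of "n - (2 * k + 1)"] coeff_heat_poly_odd[OF k] by simp
  next
    fix k assume "2 * k + 2 \<le> n"
    hence k: "2 * k \<le> n" "2 * Suc k \<le> n" and d0: "d \<noteq> 0" using d by auto
    have e: "n - 2 * k - 2 = n - 2 * Suc k" "n - (2 * k + 2) = n - 2 * Suc k"
      "(of_nat (2 * k + 2) :: complex) = 2 * of_nat (Suc k)" by auto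
    show "of_nat (fact (n - 2 * k)) * coeff P (n - 2 * k) =
         - 2 * d * of_nat (2 * k + 2) * of_nat (fact (n - 2 * k - 2)) * coeff P (n - (2 * k + 2))"
      unfolding e P[of "n - 2 * k"] P[of "n - 2 * Suc k"]
        coeff_heat_poly_even[OF k(1)] coeff_heat_poly_even[OF k(2)]
      using d0 by (simp add: field_simps del: of_nat_Suc)
  qed
qed

text \<open>Equality on the real line suffices: a nonzero polynomial has finitely many
  roots.\<close>

lemma hermite_fun_multiple_iff:
  fixes P :: "complex poly"
  shows "(\<forall>x::real. poly P (of_real x) = c * of_real (hermite_fun n x))
     \<longleftrightarrow> P = smult (c * 2 ^ n) (heat_poly (- 1 / 4) n)"
proof -
  have H: "complex_of_real (hermite_fun n x) = 2 ^ n * poly (heat_poly (- 1 / 4) n) (of_real x)" for x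
    using poly_heat_poly_of_real[of "- 1 / 4" n x, where 'a = complex] by (simp add: hermite_fun_eq)
  have "P = Q" if "\<And>x::real. poly P (of_real x) = poly Q (of_real x)" for Q :: "complex poly"
  proof -
    have "range complex_of_real \<subseteq> {z. poly (P - Q) z = 0}" using that by auto
    moreover have "infinite (range complex_of_real)"
      by (auto dest: finite_imageD simp: inj_on_def infinite_UNIV_char_0)
    ultimately have "infinite {z. poly (P - Q) z = 0}" using finite_subset by blast
    thus ?thesis using poly_roots_finite[of "P - Q"] by auto
  qed
  thus ?thesis by (auto simp: H)
qed

section \<open>The equivalences, the constant and the explicit form\<close>

theorem theorem3p3:
  fixes \<mu> \<nu> a b :: complex and n :: nat and P :: "complex poly"
  assumes "a \<noteq> 0" and "b \<noteq> 0" and "Re \<mu> > 0" and "Re \<nu> > 0"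
    and "\<nu> * b^2 \<noteq> \<mu> * a^2"
    and "P \<noteq> 0" and "degree P = n"
    and "\<forall>k. 1 \<le> k \<and> k \<le> n \<longrightarrow> a^k \<noteq> b^k"
  defines "\<delta> \<equiv> delta3 \<mu> \<nu> a b"
  shows
   "let
      A = (\<exists>C. C \<noteq> 0 \<and> P = herm_rec \<delta> C n);
      B = (\<exists>Cn. \<forall>z. gauss_int P \<mu> a z = Cn * gauss_int P \<nu> b z);
      Cc = ((\<forall>k. 2*k+1 \<le> n \<longrightarrow> coeff P (n - (2*k+1)) = 0) \<and>
            (\<forall>k. 2*k+2 \<le> n \<longrightarrow>
               of_nat (fact (n - 2*k)) * coeff P (n - 2*k) =
               - 2 * \<delta> * of_nat (2*k+2) * of_nat (fact (n - 2*k - 2)) * coeff P (n - (2*k+2))))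
    in (A \<longleftrightarrow> B) \<and> (B \<longleftrightarrow> Cc) \<and>
       (A \<longrightarrow>
          (\<forall>Cn. (\<forall>z. gauss_int P \<mu> a z = Cn * gauss_int P \<nu> b z) \<longleftrightarrow>
                Cn = csqrt \<nu> / csqrt \<mu> * (a / b)^n) \<and>
          lead_coeff P / 2^n \<noteq> 0 \<and>
          P = smult (lead_coeff P / 2^n)
                (\<Sum>k\<le>n div 2. monom ((-1)^k * 2^n * of_nat (fact n) /
                   (4^k * of_nat (fact k) * of_nat (fact (n - 2*k)) * \<delta>^k)) (n - 2*k))) \<and>
       (\<delta> = 1 \<longrightarrow> (A \<longleftrightarrow> (\<exists>c. c \<noteq> 0 \<and>
            (\<forall>x::real. poly P (of_real x) = c * of_real (hermite_fun n x)))))"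
proof -
  define \<kappa> where "\<kappa> = - 1 / (4 * \<delta>)"
  define s where "s = 1 / (4 * \<mu>)"
  define t where "t = 1 / (4 * \<nu>)"
  \<comment> \<open>The pivot: each of the three conditions is shown equivalent to
    \<open>Q\<close>.\<close>
  define Q where "Q \<longleftrightarrow> P = smult (lead_coeff P) (heat_poly \<kappa> n)"
  define A where "A \<longleftrightarrow> (\<exists>C. C \<noteq> 0 \<and> P = herm_rec \<delta> C n)"
  define E where "E Cn \<longleftrightarrow> (\<forall>z. gauss_int P \<mu> a z = Cn * gauss_int P \<nu> b z)" for Cn
  have nz: "\<mu> \<noteq> 0" "\<nu> \<noteq> 0" "\<nu> * b\<^sup>2 - \<mu> * a\<^sup>2 \<noteq> 0"
    using assms by auto
  \<comment> \<open>For \<open>n < 2\<close> the hypotheses still allow \<open>a^2 = b^2\<close>,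
    which makes \<open>\<delta>\<close> zero; from \<open>n = 2\<close> on, the power condition at
    exponent 2 excludes this.\<close>
  have "n < 2 \<or> \<delta> \<noteq> 0 \<and> b\<^sup>2 * (s + \<kappa>) = a\<^sup>2 * (t + \<kappa>)"
  proof (cases "n < 2")
    case False
    with assms(8)[rule_format, of 2] have ab: "b\<^sup>2 - a\<^sup>2 \<noteq> 0" by auto
    have \<delta>: "\<delta> \<noteq> 0" using ab nz by (simp add: \<delta>_def delta3_def)
    have "\<kappa> = (\<mu> * a\<^sup>2 - \<nu> * b\<^sup>2) / (4 * ((b\<^sup>2 - a\<^sup>2) * \<mu> * \<nu>))"
      by (simp add: \<kappa>_def \<delta>_def delta3_def)
    hence "\<kappa> * (b\<^sup>2 - a\<^sup>2) = (\<mu> * a\<^sup>2 - \<nu> * b\<^sup>2) / (4 * (\<mu> * \<nu>))"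
      using ab by simp
    also have "\<dots> = a\<^sup>2 * t - b\<^sup>2 * s"
      using nz by (simp add: s_def t_def field_simps)
    finally show ?thesis using \<delta> by (simp add: algebra_simps)
  qed simp
  hence rel: "n < 2 \<or> b\<^sup>2 * (s + \<kappa>) = a\<^sup>2 * (t + \<kappa>)" and \<delta>0: "n < 2 \<or> \<delta> \<noteq> 0" by auto
  \<comment> \<open>The common factor \<open>sqrt pi\<close> cancels, and the two square roots are
    absorbed into the proportionality constant.\<close>
  have E: "E Cn \<longleftrightarrow> (\<forall>z. poly (heat s P) (a * z) = (Cn * csqrt \<mu> / csqrt \<nu>) * poly (heat t P) (b * z))" for Cn
    unfolding E_def gauss_int_eq[OF assms(3)] gauss_int_eq[OF assms(4)] s_def t_def
    using nz by (simp add: field_simps)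
  have EQ: "Q" if "E Cn" for Cn
    using heat_proportional_unique[OF assms(1,2) rel assms(6,7), of "Cn * csqrt \<mu> / csqrt \<nu>"] assms(8) that
    unfolding E Q_def by blast
  have const: "E Cn \<longleftrightarrow> Cn = csqrt \<nu> / csqrt \<mu> * (a / b) ^ n" if Q for Cn
  proof -
    have *: "poly (heat s P) (a * z) = (a / b) ^ n * poly (heat t P) (b * z)" for z
    proof -
      have "P = smult (lead_coeff P) (heat_poly \<kappa> n)" using that Q_def by simp
      hence "heat u P = smult (lead_coeff P) (heat u (heat_poly \<kappa> n))" for u
        by (metis heat_smult)
      thus ?thesis
        using heat_poly_proportional[OF assms(1,2) rel, of z] by simp
    qed
    have "(\<forall>z. poly (heat s P) (a * z) = c * poly (heat t P) (b * z)) \<longleftrightarrow> c = (a / b) ^ n" for c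
      using * heat_proportional_const[of s P a c t b] assms(2,6,7) by auto
    hence "E Cn \<longleftrightarrow> Cn * csqrt \<mu> / csqrt \<nu> = (a / b) ^ n"
      unfolding E .
    moreover have "csqrt \<mu> \<noteq> 0" "csqrt \<nu> \<noteq> 0" using nz by auto
    ultimately show ?thesis by (simp add: divide_eq_eq eq_divide_eq mult_ac)
  qed
  have AQ: "A \<longleftrightarrow> Q"
  proof
    assume A
    then obtain C where C: "P = smult (C * 2 ^ n) (heat_poly \<kappa> n)"
      unfolding A_def herm_rec_eq \<kappa>_def by blast
    \<comment> \<open>Heat polynomials are monic in degree \<open>n\<close>, which identifies
      \<open>C\<close>.\<close>
    hence "lead_coeff P = C * 2 ^ n" using assms(7) by (metis coeff_heat_poly_self coeff_smult mult.right_neutral)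
    with C show Q unfolding Q_def by metis
  next
    assume Q
    thus A using assms(6) unfolding A_def herm_rec_eq \<kappa>_def Q_def
      by (intro exI[of _ "lead_coeff P / 2 ^ n"]) auto
  qed
  have \<kappa>_pow: "\<kappa> ^ k = (- 1) ^ k / (4 ^ k * \<delta> ^ k)" for k
    by (simp only: \<kappa>_def power_divide power_mult_distrib)
  have explicit: "smult (lead_coeff P) (heat_poly \<kappa> n) = smult (lead_coeff P / 2^n)
                (\<Sum>k\<le>n div 2. monom ((-1)^k * 2^n * of_nat (fact n) /
                   (4^k * of_nat (fact k) * of_nat (fact (n - 2*k)) * \<delta>^k)) (n - 2*k))"
    unfolding heat_poly_explicit \<kappa>_pow smult_sum_right smult_monom
    by (intro sum.cong refl arg_cong2[of _ _ _ _ monom])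
       (simp add: mult_ac)
  have hermite: "A \<longleftrightarrow> (\<exists>c. c \<noteq> 0 \<and> (\<forall>x::real. poly P (of_real x) = c * of_real (hermite_fun n x)))"
    if "\<delta> = 1"
    unfolding hermite_fun_multiple_iff A_def herm_rec_eq that by simp
  have "A \<longleftrightarrow> (\<exists>Cn. E Cn)" using AQ EQ const by blast
  moreover have "Q \<longrightarrow> P = smult (lead_coeff P / 2^n)
                (\<Sum>k\<le>n div 2. monom ((-1)^k * 2^n * of_nat (fact n) /
                   (4^k * of_nat (fact k) * of_nat (fact (n - 2*k)) * \<delta>^k)) (n - 2*k))"
    unfolding explicit[symmetric] Q_def ..
  moreover have "lead_coeff P / 2 ^ n \<noteq> 0" using assms(6) by simp
  ultimately show ?thesis
    unfolding Let_def coeff_recurrence_iff[OF assms(7) \<delta>0] \<kappa>_def[symmetric] Q_def[symmetric]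
      A_def[symmetric] E_def[symmetric]
    using AQ const hermite by blast
qed

end
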